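(* Let $q\ge 2$ be an integer, let $\mathcal{Q}=\{1,q\}$, and let $n,k\ge 0$ be integers. There is a bijection between (i) the $k$-element subsets of $\mathbb{N}_n=\{1,\ldots,n\}$ such that no two elements of the subset differ by an element of $\mathcal{Q}$, and (ii) the permutations $\pi$ of $\mathbb{N}_{n+1}=\{1,\ldots,n+1\}$ satisfying $\pi(i)-i\in\{-1,0,1\}$ for all $i\in\mathbb{N}_{n+1}$ that have exactly $k$ pairs of consecutive items that have been exchanged, and such that for all $i=1,\ldots,n+2-q$, $$\max_{j=0,\ldots,q-1}\pi(i+j)-\min_{j=0,\ldots,q-1}\pi(i+j)\le q.$$
   Context: $\mathbb{N}_n=\{1,\ldots,n\}$ (empty for $n=0$). A pair of consecutive items being exchanged means that $\pi(i)=i+1$ and $\pi(i+1)=i$ for some $i$. If $n+2-q<1$ the max/min condition is vacuous. *)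

theory Defs
  imports Main "HOL-Combinatorics.Permutations"
begin

definition avoids_differences :: "nat set \<Rightarrow> nat set \<Rightarrow> bool" where
  "avoids_differences Q S \<longleftrightarrow> (\<forall>x\<in>S. \<forall>y\<in>S. \<bar>int x - int y\<bar> \<notin> int ` Q)"

definition restricted_subsets :: "nat \<Rightarrow> nat \<Rightarrow> nat set \<Rightarrow> nat set set" where
  "restricted_subsets n k Q = {S. S \<subseteq> {1..n} \<and> card S = k \<and> avoids_differences Q S}"

text \<open>A pair of exchanged consecutive items is represented by its smaller item.\<close>

definition exchanged_pairs :: "nat \<Rightarrow> (nat \<Rightarrow> nat) \<Rightarrow> nat set" where
  "exchanged_pairs m p = {i. 1 \<le> i \<and> i + 1 \<le> m \<and> p i = i + 1 \<and> p (i + 1) = i}"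

definition window_spread :: "nat \<Rightarrow> (nat \<Rightarrow> nat) \<Rightarrow> nat \<Rightarrow> int" where
  "window_spread q p i =
     int (Max ((\<lambda>j. p (i + j)) ` {0..q - 1})) - int (Min ((\<lambda>j. p (i + j)) ` {0..q - 1}))"

text \<open>The truncated subtraction makes the window range \<open>{1..n + 2 - q}\<close> empty when
  \<open>n + 2 < q\<close>, so the spread condition is vacuous there, as intended.\<close>

definition restricted_permutations :: "nat \<Rightarrow> nat \<Rightarrow> nat \<Rightarrow> (nat \<Rightarrow> nat) set" where
  "restricted_permutations n k q =
     {p. p permutes {1..n + 1} \<and>
         (\<forall>i\<in>{1..n + 1}. int (p i) - int i \<in> {-1, 0, 1}) \<and>
         card (exchanged_pairs (n + 1) p) = k \<and>
         (\<forall>i\<in>{1..n + 2 - q}. window_spread q p i \<le> int q)}"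

end

theory Submission
  imports Defs
begin

text \<open>
  A permutation that moves every item by at most one place is a product of disjoint swaps of
  neighbours, hence is determined by the set of places \<open>i\<close> at which \<open>i\<close> and \<open>i + 1\<close> are exchanged;
  the sets that occur are exactly those without two adjacent elements
  (\<open>swap_along_exchanged_pairs\<close>, \<open>exchanged_pairs_swap_along\<close>). So subsets of \<open>{1..n}\<close> avoiding the
  difference \<open>1\<close> correspond to the permutations of \<open>{1..n + 1}\<close> with unit displacements, and the
  size of the subset is the number of exchanged pairs.

  The window condition encodes the avoidance of the difference \<open>q\<close>. On the \<open>q\<close> places
  \<open>i, \<dots>, i + q - 1\<close> the values lie between \<open>i - 1\<close> and \<open>i + q\<close>, so the spread exceeds \<open>q\<close>
  only if both extremes are attained. That forces the first item of the window to be exchanged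
  with its left neighbour and the last one with its right neighbour, which says that \<open>i - 1\<close> and
  \<open>i - 1 + q\<close> are both places of exchange (\<open>window_spread_le_iff\<close>, \<open>window_condition_iff\<close>).
\<close>

section \<open>Permutations with unit displacements\<close>

definition unit_displacement :: "nat \<Rightarrow> (nat \<Rightarrow> nat) \<Rightarrow> bool" where
  "unit_displacement m p \<longleftrightarrow> p permutes {1..m} \<and> (\<forall>i. p i \<le> Suc i \<and> i \<le> Suc (p i))"

text \<open>A permutation of \<open>{1..m}\<close> fixes everything outside, so bounding the displacements on
  \<open>{1..m}\<close> bounds them everywhere.\<close>

lemma unit_displacement_iff:
  "unit_displacement m p \<longleftrightarrow>
     p permutes {1..m} \<and> (\<forall>i\<in>{1..m}. int (p i) - int i \<in> {-1, 0, 1})"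
proof (cases "p permutes {1..m}")
  case True
  have "(p i \<le> Suc i \<and> i \<le> Suc (p i)) \<longleftrightarrow>
      (i \<in> {1..m} \<longrightarrow> int (p i) - int i \<in> {-1, 0, 1})" for i
  proof (cases "i \<in> {1..m}")
    case True
    then show ?thesis by auto
  next
    case False
    then show ?thesis using permutes_not_in[OF \<open>p permutes {1..m}\<close> False] by auto
  qed
  then show ?thesis using True by (auto simp: unit_displacement_def)
qed (simp add: unit_displacement_def)

lemma unit_displacement_inv:
  assumes "unit_displacement m p"
  shows "unit_displacement m (inv p)"
proof -
  have p: "p permutes {1..m}" and d: "\<And>i. p i \<le> Suc i \<and> i \<le> Suc (p i)"
    using assms by (auto simp: unit_displacement_def)
  have "inv p i \<le> Suc i \<and> i \<le> Suc (inv p i)" for i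
    using d[of "inv p i"] permutes_inverses(1)[OF p, of i] by auto
  then show ?thesis using permutes_inv[OF p] by (simp add: unit_displacement_def)
qed

text \<open>When \<open>i\<close> goes up, something must take its place. It cannot come from below, for then \<open>i\<close>
  would have gone down by the same principle applied at \<open>i - 1\<close>; so it is \<open>i + 1\<close>.\<close>

lemma step_up_is_exchange:
  assumes "unit_displacement m p" "p i = Suc i"
  shows "p (Suc i) = i"
  using assms(2)
proof (induction i rule: less_induct)
  case (less i)
  have p: "p permutes {1..m}" and d: "\<And>i. p i \<le> Suc i \<and> i \<le> Suc (p i)"
    using assms(1) by (auto simp: unit_displacement_def)
  obtain j where j: "p j = i" using permutes_surj[OF p] by (metis surj_def)
  have "j \<noteq> i" using j less.prems by auto
  moreover have "Suc j \<noteq> i"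
  proof
    assume "Suc j = i"
    then have "p (Suc j) = j" using less.IH[of j] j by auto
    then show False using \<open>Suc j = i\<close> less.prems by simp
  qed
  ultimately have "j = Suc i" using d[of j] j by linarith
  then show ?case using j by simp
qed

text \<open>A step down is a step up of the inverse permutation.\<close>

lemma step_down_is_exchange:
  assumes "unit_displacement m p" "p (Suc i) = i"
  shows "p i = Suc i"
proof -
  have p: "p permutes {1..m}" using assms(1) by (simp add: unit_displacement_def)
  have "inv p i = Suc i" using assms(2) permutes_inverses(2)[OF p, of "Suc i"] by simp
  then have "inv p (Suc i) = i"
    by (rule step_up_is_exchange[OF unit_displacement_inv[OF assms(1)]])
  then show ?thesis using permutes_inverses(1)[OF p, of "Suc i"] by simp
qed

text \<open>The range restrictions in the set of exchanged pairs are automatic, because a permutation of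
  \<open>{1..m}\<close> moves nothing outside.\<close>

lemma mem_exchanged_pairs_iff:
  assumes "unit_displacement m p"
  shows "i \<in> exchanged_pairs m p \<longleftrightarrow> p i = Suc i"
proof
  assume up: "p i = Suc i"
  have p: "p permutes {1..m}" using assms by (simp add: unit_displacement_def)
  have "i \<in> {1..m}" using permutes_not_in[OF p, of i] up by auto
  moreover from this have "Suc i \<in> {1..m}" using permutes_in_image[OF p, of i] up by simp
  ultimately show "i \<in> exchanged_pairs m p"
    using up step_up_is_exchange[OF assms up] by (simp add: exchanged_pairs_def)
qed (simp add: exchanged_pairs_def)

section \<open>Correspondence with sets without adjacent elements\<close>

text \<open>The product of the swaps of \<open>i\<close> and \<open>i + 1\<close> for \<open>i \<in> S\<close>, when these swaps are disjoint. The
  truncated \<open>i - 1\<close> at \<open>i = 0\<close> is harmless as long as \<open>0 \<notin> S\<close>.\<close>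

definition swap_along :: "nat set \<Rightarrow> nat \<Rightarrow> nat" where
  "swap_along S i = (if i \<in> S then Suc i else if i - 1 \<in> S then i - 1 else i)"

lemma unit_displacement_swap_along:
  assumes "S \<subseteq> {1..n}" "\<forall>x\<in>S. Suc x \<notin> S"
  shows "unit_displacement (n + 1) (swap_along S)"
proof -
  have zero: "0 \<notin> S" using assms(1) by auto
  have involution: "swap_along S (swap_along S i) = i" for i
  proof (cases i)
    case 0
    then show ?thesis using zero by (simp add: swap_along_def)
  next
    case (Suc j)
    then show ?thesis using assms(2) by (simp add: swap_along_def)
  qed
  have "swap_along S i = i" if "i \<notin> {1..n + 1}" for i
  proof -
    have "i \<notin> S" "i - 1 \<notin> S" using that assms(1) by fastforce+
    then show ?thesis by (simp add: swap_along_def)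
  qed
  then have "swap_along S permutes {1..n + 1}"
    unfolding permutes_def using involution by metis
  then show ?thesis by (auto simp: unit_displacement_def swap_along_def)
qed

lemma exchanged_pairs_swap_along:
  assumes "S \<subseteq> {1..n}" "\<forall>x\<in>S. Suc x \<notin> S"
  shows "exchanged_pairs (n + 1) (swap_along S) = S"
proof -
  have "i \<in> S \<longleftrightarrow> swap_along S i = Suc i" for i
    by (auto simp: swap_along_def)
  then show ?thesis
    unfolding set_eq_iff mem_exchanged_pairs_iff[OF unit_displacement_swap_along[OF assms]]
    by simp
qed

lemma swap_along_exchanged_pairs:
  assumes "unit_displacement m p"
  shows "swap_along (exchanged_pairs m p) = p"
proof
  fix i
  have d: "p i \<le> Suc i \<and> i \<le> Suc (p i)" using assms by (simp add: unit_displacement_def)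
  note mem = mem_exchanged_pairs_iff[OF assms]
  consider "p i = Suc i" | "p i = i" | "Suc (p i) = i" using d by linarith
  then show "swap_along (exchanged_pairs m p) i = p i"
  proof cases
    case 2
    \<comment> \<open>If \<open>i - 1\<close> went up, \<open>i\<close> would go down.\<close>
    then have "p (i - 1) \<noteq> Suc (i - 1)"
      using step_up_is_exchange[OF assms, of "i - 1"] by (cases i) auto
    then show ?thesis using 2 by (simp add: swap_along_def mem)
  next
    case 3
    then have "p (p i) = i" using step_down_is_exchange[OF assms, of "p i"] by simp
    moreover have "p i = i - 1" using 3 by simp
    ultimately show ?thesis using 3 by (simp add: swap_along_def mem)
  qed (simp add: swap_along_def mem)
qed

lemma exchanged_pairs_subset: "exchanged_pairs (n + 1) p \<subseteq> {1..n}"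
  by (auto simp: exchanged_pairs_def)

lemma exchanged_pairs_not_adjacent:
  "x \<in> exchanged_pairs m p \<Longrightarrow> Suc x \<notin> exchanged_pairs m p"
  by (auto simp: exchanged_pairs_def)

section \<open>Window spread and the difference \<open>q\<close>\<close>

text \<open>Two values in the window differ by at most the distance of their places plus \<open>2\<close>. To exceed
  \<open>q\<close>, the distance must be the full \<open>q - 1\<close> and both displacements must point outwards.\<close>

lemma window_spread_le_iff:
  assumes "q \<ge> 1" "\<And>j. p j \<le> Suc j \<and> j \<le> Suc (p j)"
  shows "window_spread q p i \<le> int q \<longleftrightarrow> \<not> (Suc (p i) = i \<and> p (i + q - 1) = i + q)"
proof -
  let ?V = "(\<lambda>j. p (i + j)) ` {0..q - 1}"
  have fin: "finite ?V" and ne: "?V \<noteq> {}" by auto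
  have first: "p i \<in> ?V" by (rule image_eqI[of _ _ 0]) auto
  have last: "p (i + q - 1) \<in> ?V" using assms(1) by (intro image_eqI[of _ _ "q - 1"]) auto
  show ?thesis
  proof
    assume le: "window_spread q p i \<le> int q"
    have "p (i + q - 1) \<le> Max ?V" "Min ?V \<le> p i"
      using fin first last by simp_all
    then show "\<not> (Suc (p i) = i \<and> p (i + q - 1) = i + q)"
      using le unfolding window_spread_def by linarith
  next
    assume not_outward: "\<not> (Suc (p i) = i \<and> p (i + q - 1) = i + q)"
    obtain a where a: "Max ?V = p (i + a)" "a \<in> {0..q - 1}"
      using Max_in[OF fin ne] by (rule imageE)
    obtain b where b: "Min ?V = p (i + b)" "b \<in> {0..q - 1}"
      using Min_in[OF fin ne] by (rule imageE)
    show "window_spread q p i \<le> int q"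
    proof (rule ccontr)
      assume "\<not> window_spread q p i \<le> int q"
      then have gt: "p (i + a) > p (i + b) + q"
        unfolding window_spread_def a(1) b(1) by linarith
      moreover have "a \<le> q - 1" "b \<le> q - 1" using a(2) b(2) by simp_all
      ultimately have "a = q - 1" "b = 0"
        using assms(2)[of "i + a"] assms(2)[of "i + b"] by linarith+
      then have "p (i + q - 1) > p i + q" using gt assms(1) by simp
      then have "Suc (p i) = i \<and> p (i + q - 1) = i + q"
        using assms(1) assms(2)[of i] assms(2)[of "i + q - 1"] by linarith
      then show False using not_outward by simp
    qed
  qed
qed

text \<open>A pair \<open>x\<close>, \<open>x + q\<close> of exchanges corresponds to the window starting at \<open>x + 1\<close>. In the first
  and the last window one of the extreme values is outside \<open>{1..n + 1}\<close>, so these never violate the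
  condition, in accordance with \<open>1 \<le> x\<close> and \<open>x + q \<le> n\<close>.\<close>

lemma window_condition_iff:
  assumes "q \<ge> 1" "unit_displacement (n + 1) p"
  shows "(\<forall>i\<in>{1..n + 2 - q}. window_spread q p i \<le> int q) \<longleftrightarrow>
    (\<forall>x\<in>exchanged_pairs (n + 1) p. x + q \<notin> exchanged_pairs (n + 1) p)"
    (is "?W \<longleftrightarrow> (\<forall>x\<in>?E. x + q \<notin> ?E)")
proof -
  have p: "p permutes {1..n + 1}" and d: "\<And>j. p j \<le> Suc j \<and> j \<le> Suc (p j)"
    using assms(2) by (auto simp: unit_displacement_def)
  note spread = window_spread_le_iff[of q p, OF assms(1) d]
  note mem = mem_exchanged_pairs_iff[OF assms(2)]
  show ?thesis
  proof (intro iffI ballI notI)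
    fix x assume W: ?W and x: "x \<in> ?E" "x + q \<in> ?E"
    have "x + q \<le> n" using exchanged_pairs_subset x(2) by fastforce
    then have "window_spread q p (Suc x) \<le> int q" using W by simp
    moreover have "p (Suc x) = x" using x(1) by (simp add: exchanged_pairs_def)
    moreover have "p (x + q) = Suc (x + q)" using x(2) unfolding mem .
    ultimately show False by (simp add: spread)
  next
    fix i assume E: "\<forall>x\<in>?E. x + q \<notin> ?E" and i: "i \<in> {1..n + 2 - q}"
    show "window_spread q p i \<le> int q"
    proof (rule ccontr)
      assume "\<not> window_spread q p i \<le> int q"
      then have first: "Suc (p i) = i" and last: "p (i + q - 1) = i + q"
        by (simp_all add: spread)
      have "p (p i) = i" using step_down_is_exchange[OF assms(2), of "p i"] first by simp
      then have "p i \<in> ?E" unfolding mem using first by simp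
      moreover have "p i + q = i + q - 1" using first by simp
      then have "p i + q \<in> ?E" unfolding mem using first last by simp
      ultimately show False using E by blast
    qed
  qed
qed

section \<open>The bijection\<close>

lemma avoids_differences_1_iff:
  assumes "q \<ge> 1"
  shows "avoids_differences {1, q} S \<longleftrightarrow> (\<forall>x\<in>S. Suc x \<notin> S) \<and> (\<forall>x\<in>S. x + q \<notin> S)"
proof
  assume "avoids_differences {1, q} S"
  then have avoid: "x \<in> S \<Longrightarrow> y \<in> S \<Longrightarrow> \<bar>int x - int y\<bar> \<notin> {1, int q}" for x y
    by (auto simp: avoids_differences_def)
  show "(\<forall>x\<in>S. Suc x \<notin> S) \<and> (\<forall>x\<in>S. x + q \<notin> S)"
  proof (intro conjI ballI notI)
    fix x assume x: "x \<in> S"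
    show False if "Suc x \<in> S" using avoid[OF that x] by simp
    show False if "x + q \<in> S" using avoid[OF that x] by simp
  qed
next
  assume avoid: "(\<forall>x\<in>S. Suc x \<notin> S) \<and> (\<forall>x\<in>S. x + q \<notin> S)"
  have "\<bar>int x - int y\<bar> \<noteq> 1 \<and> \<bar>int x - int y\<bar> \<noteq> int q" if "x \<in> S" "y \<in> S" for x y
  proof -
    have "y \<noteq> Suc x" "x \<noteq> Suc y" "y \<noteq> x + q" "x \<noteq> y + q" using avoid that by auto
    then show ?thesis by linarith
  qed
  then show "avoids_differences {1, q} S" by (simp add: avoids_differences_def)
qed

lemma mem_restricted_permutations_iff:
  assumes "q \<ge> 1"
  shows "p \<in> restricted_permutations n k q \<longleftrightarrow>
    unit_displacement (n + 1) p \<and> exchanged_pairs (n + 1) p \<in> restricted_subsets n k {1, q}"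
proof (cases "unit_displacement (n + 1) p")
  case True
  then show ?thesis
    using window_condition_iff[OF assms True] exchanged_pairs_subset[of n p]
      exchanged_pairs_not_adjacent[of _ "n + 1" p]
    unfolding restricted_permutations_def restricted_subsets_def unit_displacement_iff
      avoids_differences_1_iff[OF assms]
    by blast
next
  case False
  then show ?thesis by (auto simp: restricted_permutations_def unit_displacement_iff)
qed

theorem theorem8:
  fixes q n k :: nat
  assumes "q \<ge> 2"
  shows "\<exists>f. bij_betw f (restricted_subsets n k {1, q}) (restricted_permutations n k q)"
proof -
  have q: "q \<ge> 1" using assms by simp
  note mem = mem_restricted_permutations_iff[OF q]
  have S: "S \<subseteq> {1..n}" "\<forall>x\<in>S. Suc x \<notin> S" if "S \<in> restricted_subsets n k {1, q}" for S
    using that unfolding restricted_subsets_def avoids_differences_1_iff[OF q] by blast+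
  have "bij_betw swap_along (restricted_subsets n k {1, q}) (restricted_permutations n k q)"
  proof (rule bij_betw_byWitness[where f' = "exchanged_pairs (n + 1)"])
    show "\<forall>S\<in>restricted_subsets n k {1, q}. exchanged_pairs (n + 1) (swap_along S) = S"
      by (intro ballI exchanged_pairs_swap_along S)
    show "\<forall>p\<in>restricted_permutations n k q. swap_along (exchanged_pairs (n + 1) p) = p"
      by (intro ballI swap_along_exchanged_pairs) (simp only: mem)
    show "swap_along ` restricted_subsets n k {1, q} \<subseteq> restricted_permutations n k q"
    proof (rule image_subsetI)
      fix S assume "S \<in> restricted_subsets n k {1, q}"
      then show "swap_along S \<in> restricted_permutations n k q"
        unfolding mem using exchanged_pairs_swap_along[OF S] unit_displacement_swap_along[OF S]
        by simp
    qed
    show "exchanged_pairs (n + 1) ` restricted_permutations n k q \<subseteq> restricted_subsets n k {1, q}"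
      by (intro image_subsetI) (simp only: mem)
  qed
  then show ?thesis by blast
qed

end
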